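(* There is no algorithm which, on input $(f,s)$, where $f:\mathbb{R}^n\to\mathbb{R}^n$ is a real analytic function and $s$ is a hyperbolic sink of the dynamical system defined by $f$, computes the basin of attraction of $s$.
   Context: Dynamical systems. A function $f:\mathbb{R}^n\to\mathbb{R}^n$ defines a discrete-time dynamical system, in which the trajectory starting at $x_0$ is the sequence of iterates $x_0, f(x_0), f(f(x_0)),\ldots$, or a continuous-time dynamical system, in which the trajectory starting at $x_0$ is the solution of $x'=f(x)$, $x(0)=x_0$. A fixed point (equilibrium) is a point $s$ with $f(s)=s$ (discrete-time) or $f(s)=0$ (continuous-time). The basin of attraction of $s$ is the set of all $x$ such that the trajectory starting at $x$ converges to $s$ as time tends to $\infty$. A fixed point $s$ is a sink if some neighborhood of $s$ is contained in its basin of attraction. A sink $s$ is hyperbolic if all eigenvalues of the Jacobian $Df(s)$ have absolute value $<1$ (discrete-time), respectively negative real part (continuous-time). The basin of attraction of a hyperbolic sink is an open set. Algorithms. An algorithm is a single oracle Turing machine that must work for all admissible inputs; the dimension $n$ and the kind of system (discrete-time or continuous-time) are provided to it as part of the input, and it accesses $f$ and $s$ through oracles. An oracle for a real number $x$ is a function $\phi:\mathbb{N}\to\mathbb{Q}$ with $|x-\phi(k)|\le 2^{-k}$ for all $k\in\mathbb{N}$; an oracle for a point of $\mathbb{R}^n$ is a tuple of oracles for its coordinates. An oracle for $f$ is a function assigning to each closed cube $Q\subset\mathbb{R}^n$ with rational vertices and each $k\in\mathbb{N}$ an $n$-tuple $p$ of polynomials with rational coefficients such that $\sup_{x\in Q}\|f(x)-p(x)\|_\infty\le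 2^{-k}$. The algorithm computes an open set $O\subseteq\mathbb{R}^n$ (here the basin of attraction) if, for every choice of oracles for the input, it outputs an oracle for $O$, namely an enumeration of all closed balls with rational center and rational radius $>0$ contained in $O$, together with an enumeration of all open balls with rational center and rational radius $>0$ that intersect $\mathbb{R}^n\setminus O$. *)

theory Defs
  imports
    "HOL-Analysis.Analysis"
    "HOL-Library.Nat_Bijection"
    "HOL-Library.Poly_Mapping"
    "Jordan_Normal_Form.Char_Poly"
begin

section \<open>Dynamical systems on $\mathbb{R}^n$\<close>

text \<open>
  The dimension is an input of the algorithm, so it has to be a term. Points of $\mathbb{R}^n$
  are elements of \<^term>\<open>topspace (Euclidean_space n)\<close>, i.e. sequences that vanish from
  index \<open>n\<close> on; the values of a map outside this set are irrelevant.
\<close>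

abbreviation Rn :: "nat \<Rightarrow> (nat \<Rightarrow> real) set" where
  "Rn n \<equiv> topspace (Euclidean_space n)"

text \<open>Monomials in \<open>n\<close> variables, given by their exponents; also used as multi-indices.\<close>

definition monomials :: "nat \<Rightarrow> (nat \<Rightarrow>\<^sub>0 nat) set" where
  "monomials n = {\<alpha>. Poly_Mapping.keys \<alpha> \<subseteq> {..<n}}"

definition monomial_eval :: "nat \<Rightarrow> (nat \<Rightarrow>\<^sub>0 nat) \<Rightarrow> (nat \<Rightarrow> real) \<Rightarrow> real" where
  "monomial_eval n \<alpha> x = (\<Prod>i<n. x i ^ Poly_Mapping.lookup \<alpha> i)"

definition real_analytic :: "nat \<Rightarrow> ((nat \<Rightarrow> real) \<Rightarrow> real) \<Rightarrow> bool" where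
  "real_analytic n g \<longleftrightarrow>
     (\<forall>a\<in>Rn n. \<exists>r>0. \<exists>c :: (nat \<Rightarrow>\<^sub>0 nat) \<Rightarrow> real. \<forall>x\<in>Rn n. (\<forall>i<n. \<bar>x i - a i\<bar> < r) \<longrightarrow>
        ((\<lambda>\<alpha>. c \<alpha> * monomial_eval n \<alpha> (\<lambda>i. x i - a i)) has_sum g x) (monomials n))"

definition real_analytic_map :: "nat \<Rightarrow> ((nat \<Rightarrow> real) \<Rightarrow> (nat \<Rightarrow> real)) \<Rightarrow> bool" where
  "real_analytic_map n f \<longleftrightarrow> f \<in> Rn n \<rightarrow> Rn n \<and> (\<forall>i<n. real_analytic n (\<lambda>x. f x i))"

datatype time_kind = Discrete | Continuous

fun fixed_point :: "time_kind \<Rightarrow> nat \<Rightarrow> ((nat \<Rightarrow> real) \<Rightarrow> (nat \<Rightarrow> real)) \<Rightarrow> (nat \<Rightarrow> real) \<Rightarrow> bool" where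
  "fixed_point Discrete n f s \<longleftrightarrow> s \<in> Rn n \<and> f s = s"
| "fixed_point Continuous n f s \<longleftrightarrow> s \<in> Rn n \<and> f s = (\<lambda>i. 0)"

definition solution_from ::
  "nat \<Rightarrow> ((nat \<Rightarrow> real) \<Rightarrow> (nat \<Rightarrow> real)) \<Rightarrow> (nat \<Rightarrow> real) \<Rightarrow> (real \<Rightarrow> (nat \<Rightarrow> real)) \<Rightarrow> bool" where
  "solution_from n f x0 u \<longleftrightarrow> u 0 = x0 \<and>
     (\<forall>t\<ge>0. u t \<in> Rn n \<and>
        (\<forall>i<n. ((\<lambda>\<tau>. u \<tau> i) has_real_derivative f (u t) i) (at t within {0..})))"

text \<open>
  In continuous time a point whose trajectory is not defined for all \<open>t \<ge> 0\<close> lies in no basin.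
  For the maps considered here solutions are unique, so the existential quantifier over
  \<open>u\<close> speaks about the trajectory of \<open>x\<close>.
\<close>

fun basin :: "time_kind \<Rightarrow> nat \<Rightarrow> ((nat \<Rightarrow> real) \<Rightarrow> (nat \<Rightarrow> real)) \<Rightarrow> (nat \<Rightarrow> real) \<Rightarrow> (nat \<Rightarrow> real) set" where
  "basin Discrete n f s =
     {x \<in> Rn n. limitin (Euclidean_space n) (\<lambda>k. (f ^^ k) x) s sequentially}"
| "basin Continuous n f s =
     {x \<in> Rn n. \<exists>u. solution_from n f x u \<and> limitin (Euclidean_space n) u s at_top}"

definition sink :: "time_kind \<Rightarrow> nat \<Rightarrow> ((nat \<Rightarrow> real) \<Rightarrow> (nat \<Rightarrow> real)) \<Rightarrow> (nat \<Rightarrow> real) \<Rightarrow> bool" where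
  "sink kind n f s \<longleftrightarrow> fixed_point kind n f s \<and>
     (\<exists>U. openin (Euclidean_space n) U \<and> s \<in> U \<and> U \<subseteq> basin kind n f s)"

text \<open>Entry \<open>(i, j)\<close> is the partial derivative of the \<open>i\<close>-th component in direction \<open>j\<close>.\<close>

definition jacobian :: "nat \<Rightarrow> ((nat \<Rightarrow> real) \<Rightarrow> (nat \<Rightarrow> real)) \<Rightarrow> (nat \<Rightarrow> real) \<Rightarrow> complex mat" where
  "jacobian n f s = mat n n (\<lambda>(i, j). complex_of_real (deriv (\<lambda>h. f (s(j := h)) i) (s j)))"

fun stable_eigenvalue :: "time_kind \<Rightarrow> complex \<Rightarrow> bool" where
  "stable_eigenvalue Discrete z \<longleftrightarrow> cmod z < 1"
| "stable_eigenvalue Continuous z \<longleftrightarrow> Re z < 0"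

definition hyperbolic_sink ::
  "time_kind \<Rightarrow> nat \<Rightarrow> ((nat \<Rightarrow> real) \<Rightarrow> (nat \<Rightarrow> real)) \<Rightarrow> (nat \<Rightarrow> real) \<Rightarrow> bool" where
  "hyperbolic_sink kind n f s \<longleftrightarrow> sink kind n f s \<and>
     (\<forall>z. eigenvalue (jacobian n f s) z \<longrightarrow> stable_eigenvalue kind z)"


section \<open>Oracle Turing machines\<close>

text \<open>
  Deterministic multi-tape machines with finitely many states and symbols and two-way infinite
  tapes. A number \<open>m\<close> is written on a tape as \<open>m\<close> strokes (symbol 1) starting at cell 0;
  symbol 0 is the blank. Tape 0 initially carries the input. Tape 1 is the query tape: in the
  query state, the number on it is replaced by the answer, and the machine passes to its answer
  state. Tape 2 is the output tape: whenever the machine is in its inside state (or its outside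
  state), the number on tape 2 is printed as the next item of the first (or second)
  enumeration. Apart from printing, these two states are ordinary ones. The machine need not
  halt.
\<close>

datatype head_move = Move_Left | Stay | Move_Right

record oracle_machine =
  tape_count :: nat
  symbol_count :: nat
  state_count :: nat
  start_state :: nat
  query_state :: nat
  answer_state :: nat
  inside_state :: nat
  outside_state :: nat
  delta :: "nat \<Rightarrow> nat list \<Rightarrow> nat \<times> (nat \<times> head_move) list"

definition wf_machine :: "oracle_machine \<Rightarrow> bool" where
  "wf_machine M \<longleftrightarrow>
     3 \<le> tape_count M \<and> 2 \<le> symbol_count M \<and>
     {start_state M, query_state M, answer_state M, inside_state M, outside_state M}
       \<subseteq> {..<state_count M} \<and>
     (\<forall>q<state_count M. \<forall>v. length v = tape_count M \<and> set v \<subseteq> {..<symbol_count M} \<longrightarrow>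
        (case delta M q v of (q', acts) \<Rightarrow>
           q' < state_count M \<and> length acts = tape_count M \<and> fst ` set acts \<subseteq> {..<symbol_count M}))"

text \<open>A tape is given by its contents and the position of the head.\<close>

type_synonym tape = "(int \<Rightarrow> nat) \<times> int"

definition write_number :: "nat \<Rightarrow> tape" where
  "write_number m = ((\<lambda>i. if 0 \<le> i \<and> i < int m then 1 else 0), 0)"

definition read_number :: "tape \<Rightarrow> nat" where
  "read_number T = (LEAST m. fst T (int m) \<noteq> 1)"

definition scanned :: "tape \<Rightarrow> nat" where
  "scanned T = fst T (snd T)"

fun head_shift :: "head_move \<Rightarrow> int" where
  "head_shift Move_Left = - 1"
| "head_shift Stay = 0"
| "head_shift Move_Right = 1"

definition act_on :: "tape \<Rightarrow> nat \<times> head_move \<Rightarrow> tape" where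
  "act_on T a = ((fst T)(snd T := fst a), snd T + head_shift (snd a))"

type_synonym config = "nat \<times> tape list"

definition initial_config :: "oracle_machine \<Rightarrow> nat \<Rightarrow> config" where
  "initial_config M input =
     (start_state M, write_number input # replicate (tape_count M - 1) (write_number 0))"

fun machine_step :: "oracle_machine \<Rightarrow> (nat \<Rightarrow> nat) \<Rightarrow> config \<Rightarrow> config" where
  "machine_step M \<Omega> (q, Ts) =
     (if q = query_state M
      then (answer_state M, Ts[1 := write_number (\<Omega> (read_number (Ts ! 1)))])
      else (case delta M q (map scanned Ts) of (q', acts) \<Rightarrow> (q', map2 act_on Ts acts)))"

definition machine_run :: "oracle_machine \<Rightarrow> (nat \<Rightarrow> nat) \<Rightarrow> nat \<Rightarrow> nat \<Rightarrow> config" where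
  "machine_run M \<Omega> input t = (machine_step M \<Omega> ^^ t) (initial_config M input)"

text \<open>The set of numbers printed whenever the machine is in state \<open>q\<close>.\<close>

definition printed :: "oracle_machine \<Rightarrow> nat \<Rightarrow> (nat \<Rightarrow> nat) \<Rightarrow> nat \<Rightarrow> nat set" where
  "printed M q \<Omega> input =
     {read_number (Ts ! 2) | t Ts. machine_run M \<Omega> input t = (q, Ts)}"


section \<open>Names of points, maps and open sets\<close>

text \<open>
  Finite objects are coded by numbers through the computable bijections of
  \<^theory>\<open>HOL-Library.Nat_Bijection\<close>. Numbers that the machine produces are decoded; a rational
  then has many codes. Numbers that the machine receives are encoded, a rational as the
  reduced fraction.
\<close>

definition rat_encode :: "rat \<Rightarrow> nat" where
  "rat_encode r = (case quotient_of r of (a, b) \<Rightarrow> prod_encode (int_encode a, nat b))"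

definition rat_decode :: "nat \<Rightarrow> rat" where
  "rat_decode c = (case prod_decode c of (a, b) \<Rightarrow> of_int (int_decode a) / of_nat b)"

lemma rat_decode_encode: "rat_decode (rat_encode r) = r"
proof (cases "quotient_of r")
  case (Pair a b)
  then show ?thesis
    using quotient_of_denom_pos[OF Pair] quotient_of_div[OF Pair]
    by (simp add: rat_encode_def rat_decode_def)
qed

text \<open>
  Pairs of a point of $\mathbb{Q}^n$ and a positive rational. Such a pair stands for a cube
  (least corner and side length) or for a ball (center and radius).
\<close>

definition frames :: "nat \<Rightarrow> (rat list \<times> rat) set" where
  "frames n = {(a, r). length a = n \<and> 0 < r}"

definition frame_decode :: "nat \<Rightarrow> rat list \<times> rat" where
  "frame_decode c =
     (case prod_decode c of (a, r) \<Rightarrow> (map rat_decode (list_decode a), rat_decode r))"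

definition cube_of :: "nat \<Rightarrow> rat list \<times> rat \<Rightarrow> (nat \<Rightarrow> real) set" where
  "cube_of n Q =
     {x \<in> Rn n. \<forall>i<n. real_of_rat (fst Q ! i) \<le> x i \<and> x i \<le> real_of_rat (fst Q ! i + snd Q)}"

definition closed_ball_of :: "nat \<Rightarrow> rat list \<times> rat \<Rightarrow> (nat \<Rightarrow> real) set" where
  "closed_ball_of n B =
     {x \<in> Rn n. L2_set (\<lambda>i. x i - real_of_rat (fst B ! i)) {..<n} \<le> real_of_rat (snd B)}"

definition open_ball_of :: "nat \<Rightarrow> rat list \<times> rat \<Rightarrow> (nat \<Rightarrow> real) set" where
  "open_ball_of n B =
     {x \<in> Rn n. L2_set (\<lambda>i. x i - real_of_rat (fst B ! i)) {..<n} < real_of_rat (snd B)}"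

text \<open>Polynomials with rational coefficients, as finitely supported coefficient functions.\<close>

type_synonym rat_poly = "(nat \<Rightarrow>\<^sub>0 nat) \<Rightarrow>\<^sub>0 rat"

definition rat_polys :: "nat \<Rightarrow> rat_poly set" where
  "rat_polys n = {p. Poly_Mapping.keys p \<subseteq> monomials n}"

definition rat_poly_eval :: "nat \<Rightarrow> rat_poly \<Rightarrow> (nat \<Rightarrow> real) \<Rightarrow> real" where
  "rat_poly_eval n p x =
     (\<Sum>\<alpha>\<in>Poly_Mapping.keys p. real_of_rat (Poly_Mapping.lookup p \<alpha>) * monomial_eval n \<alpha> x)"

definition rat_poly_encode :: "nat \<Rightarrow> rat_poly \<Rightarrow> nat" where
  "rat_poly_encode n p =
     list_encode
       (map (\<lambda>\<alpha>. prod_encode (rat_encode (Poly_Mapping.lookup p \<alpha>),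
                              list_encode (map (Poly_Mapping.lookup \<alpha>) [0..<n])))
            (sorted_list_of_set (Poly_Mapping.keys p)))"

definition point_oracle :: "nat \<Rightarrow> (nat \<Rightarrow> real) \<Rightarrow> (nat \<Rightarrow> nat \<Rightarrow> rat) \<Rightarrow> bool" where
  "point_oracle n s \<phi> \<longleftrightarrow> (\<forall>i<n. \<forall>k. \<bar>s i - real_of_rat (\<phi> i k)\<bar> \<le> 1 / 2 ^ k)"

definition map_oracle ::
  "nat \<Rightarrow> ((nat \<Rightarrow> real) \<Rightarrow> (nat \<Rightarrow> real)) \<Rightarrow> (rat list \<times> rat \<Rightarrow> nat \<Rightarrow> nat \<Rightarrow> rat_poly) \<Rightarrow> bool" where
  "map_oracle n f \<psi> \<longleftrightarrow>
     (\<forall>Q\<in>frames n. \<forall>k. \<forall>i<n. \<psi> Q k i \<in> rat_polys n \<and>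
        (\<forall>x\<in>cube_of n Q. \<bar>f x i - rat_poly_eval n (\<psi> Q k i) x\<bar> \<le> 1 / 2 ^ k))"

text \<open>
  Both oracles are joined into one: an even query asks for an approximation of a coordinate of
  the point, an odd query for a tuple of polynomials. Meaningless queries are answered by 0.
\<close>

definition joint_oracle ::
  "nat \<Rightarrow> (nat \<Rightarrow> nat \<Rightarrow> rat) \<Rightarrow> (rat list \<times> rat \<Rightarrow> nat \<Rightarrow> nat \<Rightarrow> rat_poly) \<Rightarrow> nat \<Rightarrow> nat" where
  "joint_oracle n \<phi> \<psi> query =
     (case sum_decode query of
        Inl c \<Rightarrow> (case prod_decode c of (i, k) \<Rightarrow> if i < n then rat_encode (\<phi> i k) else 0)
      | Inr c \<Rightarrow> (case prod_decode c of (d, k) \<Rightarrow>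
          if frame_decode d \<in> frames n
          then list_encode (map (\<lambda>i. rat_poly_encode n (\<psi> (frame_decode d) k i)) [0..<n])
          else 0))"

fun input_code :: "time_kind \<Rightarrow> nat \<Rightarrow> nat" where
  "input_code Discrete n = prod_encode (0, n)"
| "input_code Continuous n = prod_encode (1, n)"

text \<open>The second enumeration is empty exactly if the open set is the whole space.\<close>

definition outputs_open_set ::
  "oracle_machine \<Rightarrow> nat \<Rightarrow> (nat \<Rightarrow> nat) \<Rightarrow> nat \<Rightarrow> (nat \<Rightarrow> real) set \<Rightarrow> bool" where
  "outputs_open_set M n \<Omega> input X \<longleftrightarrow>
     frame_decode ` printed M (inside_state M) \<Omega> input
       = {B \<in> frames n. closed_ball_of n B \<subseteq> X} \<and>
     frame_decode ` printed M (outside_state M) \<Omega> input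
       = {B \<in> frames n. open_ball_of n B \<inter> (Rn n - X) \<noteq> {}}"

end

theory Submission
  imports Defs
begin

text \<open>
  A machine prints an item after finitely many queries, so the item does not change under
  perturbations of the map that are small on the finitely many cubes queried. The one-dimensional
  maps \<open>x \<mapsto> x (1 - ((x - 1)\<^sup>2 + e) / 4)\<close> have the hyperbolic sink \<open>0\<close>. For \<open>e = 0\<close> there is a
  semi-stable fixed point at \<open>1\<close>, which disappears for every \<open>e > 0\<close>. Hence the ball
  around \<open>1\<close> of radius \<open>1/2\<close> meets the complement of the basin for \<open>e = 0\<close>, but not for \<open>e > 0\<close>.
\<close>

text \<open>The dimension is the literal \<open>1\<close> throughout; the simplifier should not turn
  it into \<open>Suc 0\<close>, since the lemmas below are stated for \<open>1\<close>.\<close>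

declare One_nat_def [simp del]

lemma lessThan_one_nat [simp]: "{..<1} = {0::nat}"
  by auto

section \<open>Finite use of the oracle\<close>

text \<open>One step consults the oracle at most at the number on the query tape, so each step adds
  a single element to \<open>F\<close>. It is added in every state, which avoids a case
  distinction.\<close>

lemma machine_run_finite_use:
  "\<exists>F. finite F \<and> (\<forall>\<Omega>'. (\<forall>q\<in>F. \<Omega>' q = \<Omega> q) \<longrightarrow> machine_run M \<Omega>' input t = machine_run M \<Omega> input t)"
proof (induction t)
  case 0
  show ?case by (auto simp: machine_run_def)
next
  case (Suc t)
  then obtain F where F: "finite F"
    "\<And>\<Omega>'. \<forall>q\<in>F. \<Omega>' q = \<Omega> q \<Longrightarrow> machine_run M \<Omega>' input t = machine_run M \<Omega> input t"
    by blast
  obtain q Ts where c: "machine_run M \<Omega> input t = (q, Ts)" by fastforce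
  have step: "machine_run M \<Omega>' input (Suc t) = machine_step M \<Omega>' (machine_run M \<Omega>' input t)" for \<Omega>'
    by (simp add: machine_run_def)
  show ?case
  proof (intro exI[of _ "insert (read_number (Ts ! 1)) F"] conjI allI impI)
    fix \<Omega>' :: "nat \<Rightarrow> nat"
    assume "\<forall>q\<in>insert (read_number (Ts ! 1)) F. \<Omega>' q = \<Omega> q"
    then show "machine_run M \<Omega>' input (Suc t) = machine_run M \<Omega> input (Suc t)"
      using F(2)[of \<Omega>'] by (simp add: step c)
  qed (use F in simp)
qed

section \<open>The cubic family and its basins\<close>

definition cubic :: "real \<Rightarrow> real \<Rightarrow> real" where
  "cubic e x = x * (1 - ((x - 1)\<^sup>2 + e) / 4)"

definition cubic_map :: "real \<Rightarrow> (nat \<Rightarrow> real) \<Rightarrow> (nat \<Rightarrow> real)" where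
  "cubic_map e x = (\<lambda>i. if i = 0 then cubic e (x 0) else 0)"

definition cubic_poly :: "rat \<Rightarrow> rat_poly" where
  "cubic_poly e =
     Poly_Mapping.single (Poly_Mapping.single 0 1) ((3 - e) / 4) +
     Poly_Mapping.single (Poly_Mapping.single 0 2) (1 / 2) +
     Poly_Mapping.single (Poly_Mapping.single 0 3) (- 1 / 4)"

lemma cubic_0 [simp]: "cubic e 0 = 0"
  by (simp add: cubic_def)

lemma cubic_map_in_Rn: "cubic_map e x \<in> Rn 1"
  by (simp add: cubic_map_def topspace_Euclidean_space)

lemma cubic_map_funpow:
  "x \<in> Rn 1 \<Longrightarrow> (cubic_map e ^^ k) x = (\<lambda>i. if i = 0 then (cubic e ^^ k) (x 0) else 0)"
  by (induction k) (auto simp: cubic_map_def topspace_Euclidean_space fun_eq_iff)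

text \<open>On the interval the factor \<open>1 - ((y - 1)\<^sup>2 + e) / 4\<close> lies between 0
  and \<open>q\<close>, so a step keeps the sign and shrinks the absolute value: the interval is
  invariant and the decay geometric. The end \<open>b\<close> is a parameter because 1/2 serves for
  all \<open>e\<close>, including 0, and 3/2 for positive \<open>e\<close>.\<close>

lemma cubic_funpow_tendsto_0:
  assumes b: "0 < b" "b \<le> 3/2" and e: "0 \<le> e" "e \<le> 1" and "q < 1" and x: "x \<in> {- 1/2<..<b}"
    and q: "\<And>y. y \<in> {- 1/2<..<b} \<Longrightarrow> 1 - ((y - 1)\<^sup>2 + e) / 4 \<le> q"
  shows "(\<lambda>k. (cubic e ^^ k) x) \<longlonglongrightarrow> 0"
proof -
  have step: "cubic e y \<in> {- 1/2<..<b} \<and> \<bar>cubic e y\<bar> \<le> q * \<bar>y\<bar>" if y: "y \<in> {- 1/2<..<b}" for y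
  proof -
    define r where "r = 1 - ((y - 1)\<^sup>2 + e) / 4"
    have "\<bar>y - 1\<bar> \<le> 3/2" using y b unfolding greaterThanLessThan_iff abs_le_iff by linarith
    then have "(y - 1)\<^sup>2 \<le> (3/2)\<^sup>2" by (rule power2_le_iff_abs_le[THEN iffD2, rotated]) simp
    then have r: "0 \<le> r" "r \<le> q" "r \<le> 1"
      using q[OF y] e by (auto simp: r_def power2_eq_square)
    have c: "cubic e y = r * y" by (simp add: cubic_def r_def)
    have "\<bar>r * y\<bar> \<le> q * \<bar>y\<bar>" using r by (simp add: abs_mult mult_right_mono)
    moreover have "- 1/2 < r * y \<and> r * y < b"
    proof (cases "0 \<le> y")
      case True
      then have "0 \<le> r * y" "r * y \<le> y" using r by (auto intro: mult_left_le_one_le)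
      then show ?thesis using y by auto
    next
      case False
      then have "r * y \<le> 0" "y \<le> r * y" using r
        by (auto simp: mult_nonneg_nonpos mult_le_cancel_right1 mult_le_cancel_right2)
      then show ?thesis using y b by auto
    qed
    ultimately show ?thesis by (simp add: c)
  qed
  \<comment> \<open>At the point 0 the bound reads (3 - e) / 4 \<le> q.\<close>
  have "0 \<le> q"
    using q[of 0] e b by (simp add: field_simps)
  have bound: "(cubic e ^^ k) x \<in> {- 1/2<..<b} \<and> \<bar>(cubic e ^^ k) x\<bar> \<le> q ^ k * \<bar>x\<bar>" for k
  proof (induction k)
    case (Suc k)
    then have "q * \<bar>(cubic e ^^ k) x\<bar> \<le> q * (q ^ k * \<bar>x\<bar>)"
      using \<open>0 \<le> q\<close> by (intro mult_left_mono) auto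
    then show ?case using step[of "(cubic e ^^ k) x"] Suc by auto
  qed (use x in simp)
  have "(\<lambda>k. q ^ k * \<bar>x\<bar>) \<longlonglongrightarrow> 0"
    using \<open>0 \<le> q\<close> \<open>q < 1\<close> by (auto intro!: tendsto_eq_intros LIMSEQ_realpow_zero)
  then show ?thesis
    by (rule Lim_null_comparison[rotated]) (use bound in auto)
qed

text \<open>Convergence in \<open>Euclidean_space\<close> is componentwise, and all coordinates but
  the first stay 0.\<close>

lemma in_basin_cubic_map_iff:
  "x \<in> basin Discrete 1 (cubic_map e) (\<lambda>i. 0) \<longleftrightarrow>
     x \<in> Rn 1 \<and> (\<lambda>k. (cubic e ^^ k) (x 0)) \<longlonglongrightarrow> 0"
proof -
  have "limitin (Euclidean_space 1) (\<lambda>k. (cubic_map e ^^ k) x) (\<lambda>i. 0) sequentially \<longleftrightarrow>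
      (\<lambda>k. (cubic e ^^ k) (x 0)) \<longlonglongrightarrow> 0" if "x \<in> Rn 1"
  proof -
    have 1: "(\<lambda>i. if i = 0 then c else (0::real)) \<in> {x. \<forall>i\<ge>1::nat. x i = 0}" for c
      by auto
    have "(\<lambda>k. if i = 0 then (cubic e ^^ k) (x 0) else 0) \<longlonglongrightarrow> 0 \<longleftrightarrow>
        i \<noteq> 0 \<or> (\<lambda>k. (cubic e ^^ k) (x 0)) \<longlonglongrightarrow> 0" for i :: nat
      by (cases "i = 0") auto
    then show ?thesis
      using that 1
      by (auto simp: cubic_map_funpow Euclidean_space_def limitin_subtopology
          limitin_componentwise limitin_canonical_iff)
  qed
  then show ?thesis by auto
qed

lemma sink_nbhd_subset_basin_cubic_map:
  assumes "0 < b" "b \<le> 3/2" "0 \<le> e" "e \<le> 1" "q < 1"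
    and "\<And>y. y \<in> {- 1/2<..<b} \<Longrightarrow> 1 - ((y - 1)\<^sup>2 + e) / 4 \<le> q"
  shows "{x \<in> Rn 1. x 0 \<in> {- 1/2<..<b}} \<subseteq> basin Discrete 1 (cubic_map e) (\<lambda>i. 0)"
  using cubic_funpow_tendsto_0[OF assms(1-5) _ assms(6)] by (auto simp only: in_basin_cubic_map_iff)

text \<open>Staying at distance at least 1/2 from the point 1 bounds the factor by 1 - 1/16,
  uniformly in \<open>e\<close>. The only eigenvalue is the factor at 0, namely (3 - e) / 4.\<close>

lemma hyperbolic_sink_cubic_map:
  assumes e: "0 \<le> e" "e \<le> 1"
  shows "hyperbolic_sink Discrete 1 (cubic_map e) (\<lambda>i. 0)"
proof -
  define U where "U = {x \<in> Rn 1. x 0 \<in> {- 1/2<..<1/2}}"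
  have "continuous_map (Euclidean_space 1) euclideanreal (\<lambda>x. x 0)"
    by (simp add: Euclidean_space_def continuous_map_from_subtopology
        continuous_map_product_projection[of 0 UNIV "\<lambda>_. euclideanreal", simplified])
  then have "openin (Euclidean_space 1) U"
    unfolding U_def by (rule openin_continuous_map_preimage) simp
  moreover have "(\<lambda>i. 0) \<in> U"
    by (simp add: U_def topspace_Euclidean_space)
  moreover have "U \<subseteq> basin Discrete 1 (cubic_map e) (\<lambda>i. 0)"
    unfolding U_def
  proof (rule sink_nbhd_subset_basin_cubic_map)
    fix y :: real assume "y \<in> {- 1/2<..<1/2}"
    then have "(1/2)\<^sup>2 \<le> (1 - y)\<^sup>2" by (intro power_mono) auto
    then have "1/4 \<le> (y - 1)\<^sup>2" by (simp add: power2_commute[of 1 y] power_divide)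
    then show "1 - ((y - 1)\<^sup>2 + e) / 4 \<le> 15/16"
      using e by simp
  qed (use e in auto)
  ultimately have "sink Discrete 1 (cubic_map e) (\<lambda>i. 0)"
    by (auto simp: sink_def cubic_map_def topspace_Euclidean_space)
  moreover have "cmod z < 1" if z: "eigenvalue (jacobian 1 (cubic_map e) (\<lambda>i. 0)) z" for z
  proof -
    let ?J = "jacobian 1 (cubic_map e) (\<lambda>i. 0)"
    have "(cubic e has_field_derivative (3 - e) / 4) (at 0)"
      unfolding cubic_def by (auto intro!: derivative_eq_intros simp: field_simps)
    then have J: "?J = mat 1 1 (\<lambda>_. complex_of_real ((3 - e) / 4))"
      by (intro eq_matI) (auto simp: jacobian_def cubic_map_def DERIV_imp_deriv)
    obtain v where v: "v \<in> carrier_vec 1" "v \<noteq> 0\<^sub>v 1" "?J *\<^sub>v v = z \<cdot>\<^sub>v v"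
      using z by (auto simp: eigenvalue_def eigenvector_def J)
    have "vec_index v 0 \<noteq> 0"
      using v(1,2) by (auto simp: Matrix.vec_eq_iff)
    moreover have "{0..<1} = {0::nat}" by auto
    then have "vec_index (?J *\<^sub>v v) 0 = complex_of_real ((3 - e) / 4) * vec_index v 0"
      using v(1) by (simp add: J scalar_prod_def)
    ultimately have "z = complex_of_real ((3 - e) / 4)"
      using v by auto
    then show ?thesis using e by (simp only: norm_of_real) auto
  qed
  ultimately show ?thesis by (simp add: hyperbolic_sink_def)
qed

lemma not_in_basin_cubic_map:
  "(\<lambda>i. if i = 0 then 1 else 0) \<notin> basin Discrete 1 (cubic_map 0) (\<lambda>i. 0)"
proof -
  have "(cubic 0 ^^ k) 1 = 1" for k
    by (induction k) (auto simp: cubic_def)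
  then show ?thesis by (simp add: in_basin_cubic_map_iff LIMSEQ_const_iff del: basin.simps)
qed

text \<open>For positive \<open>e\<close> the factor is at most 1 - e / 4 even at the point 1, so
  the contraction argument extends across it, up to 3/2.\<close>

lemma open_ball_subset_basin_cubic_map:
  assumes e: "0 < e" "e \<le> 1"
  shows "open_ball_of 1 ([1], 1/2) \<subseteq> basin Discrete 1 (cubic_map e) (\<lambda>i. 0)"
proof -
  have "open_ball_of 1 ([1], 1/2) \<subseteq> {x \<in> Rn 1. x 0 \<in> {- 1/2<..<3/2}}"
    by (clarsimp simp: open_ball_of_def L2_set_def of_rat_divide) (simp add: abs_if split: if_splits)
  also have "\<dots> \<subseteq> basin Discrete 1 (cubic_map e) (\<lambda>i. 0)"
    by (rule sink_nbhd_subset_basin_cubic_map[where q = "1 - e / 4"]) (use e in auto)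
  finally show ?thesis .
qed

section \<open>Analyticity and polynomial form of the family\<close>

lemma monomials_1: "monomials 1 = range (Poly_Mapping.single 0)"
proof -
  have "\<alpha> = Poly_Mapping.single 0 (Poly_Mapping.lookup \<alpha> 0)" if "\<alpha> \<in> monomials 1" for \<alpha>
    using that
    by (intro poly_mapping_eqI) (auto simp: monomials_def lookup_single when_def in_keys_iff)
  then show ?thesis
    by (auto simp: monomials_def keys_single split: if_splits)
qed

lemma monomial_eval_1: "monomial_eval 1 (Poly_Mapping.single 0 k) x = x 0 ^ k"
  by (simp add: monomial_eval_def)

lemma real_analytic_map_cubic_map: "real_analytic_map 1 (cubic_map e)"
proof -
  have "real_analytic 1 (\<lambda>x. cubic e (x 0))"
    unfolding real_analytic_def
  proof (intro ballI)
    fix a :: "nat \<Rightarrow> real"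
    \<comment> \<open>These are the Taylor coefficients of \<open>cubic e\<close> at
      \<open>a 0\<close>.\<close>
    define c where "c k = [cubic e (a 0),
        (3 - e) / 4 + a 0 - 3/4 * (a 0)\<^sup>2, 1/2 - 3/4 * a 0, - 1/4] ! k" for k
    define C where "C \<alpha> = (if Poly_Mapping.lookup \<alpha> 0 < 4 then c (Poly_Mapping.lookup \<alpha> 0) else 0)"
      for \<alpha> :: "nat \<Rightarrow>\<^sub>0 nat"
    define A where "A = Poly_Mapping.single (0::nat) ` {..<4::nat}"
    have "((\<lambda>\<alpha>. C \<alpha> * monomial_eval 1 \<alpha> (\<lambda>i. x i - a i)) has_sum cubic e (x 0)) (monomials 1)" for x
    proof -
      let ?f = "\<lambda>\<alpha>. C \<alpha> * monomial_eval 1 \<alpha> (\<lambda>i. x i - a i)"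
      have "sum ?f A = (\<Sum>k<4. c k * (x 0 - a 0) ^ k)"
        unfolding A_def
        by (subst sum.reindex) (auto intro: inj_on_subset simp: C_def monomial_eval_1)
      also have "\<dots> = cubic e (x 0)"
        by (simp add: numeral_eq_Suc c_def cubic_def field_simps power2_eq_square power3_eq_cube)
      finally have "(?f has_sum cubic e (x 0)) A"
        using has_sum_finite[of A ?f] by (simp add: A_def)
      moreover have "(?f has_sum cubic e (x 0)) A \<longleftrightarrow> (?f has_sum cubic e (x 0)) (monomials 1)"
        by (rule has_sum_cong_neutral) (auto simp: A_def monomials_1 C_def)
      ultimately show ?thesis by simp
    qed
    then show "\<exists>r>0. \<exists>c. \<forall>x\<in>Rn 1. (\<forall>i<1. \<bar>x i - a i\<bar> < r) \<longrightarrow>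
        ((\<lambda>\<alpha>. c \<alpha> * monomial_eval 1 \<alpha> (\<lambda>i. x i - a i)) has_sum cubic e (x 0)) (monomials 1)"
      \<comment> \<open>The radius 1 is arbitrary: the finite expansion holds for every
        \<open>x\<close>.\<close>
      by (intro exI[of _ 1] conjI exI[of _ C]) auto
  qed
  then show ?thesis
    using cubic_map_in_Rn[of e] by (auto simp: real_analytic_map_def cubic_map_def)
qed

lemma cubic_poly_in_rat_polys: "cubic_poly e \<in> rat_polys 1"
  and rat_poly_eval_cubic_poly: "rat_poly_eval 1 (cubic_poly e) x = cubic (of_rat e) (x 0)"
proof -
  let ?m = "Poly_Mapping.single (0::nat) :: nat \<Rightarrow> _"
  \<comment> \<open>Only an inclusion: the linear coefficient vanishes for e = 3.\<close>
  have keys: "Poly_Mapping.keys (cubic_poly e) \<subseteq> ?m ` {1, 2, 3}"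
    by (auto simp: cubic_poly_def in_keys_iff lookup_add lookup_single when_def split: if_splits)
  then show "cubic_poly e \<in> rat_polys 1"
    unfolding rat_polys_def monomials_1 by blast
  have "rat_poly_eval 1 (cubic_poly e) x =
      (\<Sum>\<alpha>\<in>?m ` {1, 2, 3}. real_of_rat (Poly_Mapping.lookup (cubic_poly e) \<alpha>) * monomial_eval 1 \<alpha> x)"
    unfolding rat_poly_eval_def using keys by (intro sum.mono_neutral_left) (auto simp: in_keys_iff)
  also have "\<dots> = (\<Sum>k\<in>{1, 2, 3}. real_of_rat (Poly_Mapping.lookup (cubic_poly e) (?m k)) * x 0 ^ k)"
    by (subst sum.reindex) (auto intro: inj_on_subset simp: monomial_eval_1)
  also have "\<dots> = cubic (of_rat e) (x 0)"
    by (simp add: cubic_poly_def lookup_add lookup_single when_def cubic_def of_rat_divide of_rat_diff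
        of_rat_minus field_simps power2_eq_square power3_eq_cube)
  finally show "rat_poly_eval 1 (cubic_poly e) x = cubic (of_rat e) (x 0)" .
qed

section \<open>Oracles that hide the perturbation\<close>

lemma cubic_diff: "cubic 0 t - cubic e t = e * t / 4"
  by (simp add: cubic_def field_simps)

text \<open>
  An oracle for the perturbed map that returns the polynomial of the unperturbed map whenever this
  is precise enough, so that any given query ceases to see the perturbation for small \<open>e\<close>.
\<close>

definition cubic_oracle :: "rat \<Rightarrow> rat list \<times> rat \<Rightarrow> nat \<Rightarrow> nat \<Rightarrow> rat_poly" where
  "cubic_oracle e Q k i =
     (if \<forall>x\<in>cube_of 1 Q. \<bar>of_rat e * x 0 / 4\<bar> \<le> 1 / 2 ^ k then cubic_poly 0 else cubic_poly e)"

lemma map_oracle_cubic: "map_oracle 1 (cubic_map (of_rat e)) (cubic_oracle e)"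
  by (auto simp: map_oracle_def cubic_oracle_def cubic_poly_in_rat_polys rat_poly_eval_cubic_poly
      cubic_map_def cubic_diff abs_minus_commute[of _ "cubic 0 _"])

text \<open>A cube is bounded, so the error bound e * R / 4 drops below the requested precision and
  the test in \<open>cubic_oracle\<close> succeeds. For e = 0 both branches return
  \<open>cubic_poly 0\<close>.\<close>

lemma eventually_cubic_oracle:
  "eventually (\<lambda>N. cubic_oracle (1 / of_nat (Suc N)) Q k = cubic_oracle 0 Q k) sequentially"
proof -
  define R where "R = \<bar>real_of_rat (fst Q ! 0)\<bar> + \<bar>real_of_rat (fst Q ! 0 + snd Q)\<bar>"
  have "(\<lambda>N. 1 / real (Suc N) * (R / 4)) \<longlonglongrightarrow> 0 * (R / 4)"
    using LIMSEQ_inverse_real_of_nat by (intro tendsto_mult tendsto_const) (simp add: inverse_eq_divide)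
  then have "eventually (\<lambda>N. 1 / real (Suc N) * (R / 4) < 1 / 2 ^ k) sequentially"
    by (rule order_tendstoD) simp
  then show ?thesis
  proof eventually_elim
    case (elim N)
    have "\<bar>of_rat (1 / of_nat (Suc N)) * x 0 / 4\<bar> \<le> 1 / 2 ^ k" if "x \<in> cube_of 1 Q" for x
    proof -
      have "\<bar>x 0\<bar> \<le> R" using that unfolding cube_of_def R_def mem_Collect_eq by (smt (verit) less_one)
      then have "1 / real (Suc N) * (\<bar>x 0\<bar> / 4) \<le> 1 / real (Suc N) * (R / 4)"
        by (intro mult_left_mono) auto
      then show ?thesis using elim by (simp add: abs_mult of_rat_divide of_rat_add)
    qed
    then show ?case by (auto simp: cubic_oracle_def fun_eq_iff)
  qed
qed

section \<open>Contradiction from a ball printed too early\<close>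

theorem corollary2p7:
  shows "\<not> (\<exists>M. wf_machine M \<and>
    (\<forall>kind n f s. 1 \<le> n \<and> real_analytic_map n f \<and> hyperbolic_sink kind n f s \<longrightarrow>
       (\<forall>\<phi> \<psi>. point_oracle n s \<phi> \<and> map_oracle n f \<psi> \<longrightarrow>
          outputs_open_set M n (joint_oracle n \<phi> \<psi>) (input_code kind n) (basin kind n f s))))"
proof
  let ?X = "\<lambda>e. basin Discrete 1 (cubic_map e) (\<lambda>i. 0)"
  let ?\<Omega> = "\<lambda>e. joint_oracle 1 (\<lambda>_ _. 0) (cubic_oracle e)"
  let ?in = "input_code Discrete 1"
  let ?B = "([1], 1/2) :: rat list \<times> rat"
  let ?e = "\<lambda>N. 1 / of_nat (Suc N) :: rat"
  assume "\<exists>M. wf_machine M \<and>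
    (\<forall>kind n f s. 1 \<le> n \<and> real_analytic_map n f \<and> hyperbolic_sink kind n f s \<longrightarrow>
       (\<forall>\<phi> \<psi>. point_oracle n s \<phi> \<and> map_oracle n f \<psi> \<longrightarrow>
          outputs_open_set M n (joint_oracle n \<phi> \<psi>) (input_code kind n) (basin kind n f s)))"
  then obtain M where M: "outputs_open_set M n (joint_oracle n \<phi> \<psi>) (input_code kind n) (basin kind n f s)"
    if "1 \<le> n" "real_analytic_map n f" "hyperbolic_sink kind n f s" "point_oracle n s \<phi>" "map_oracle n f \<psi>"
    for kind n f s \<phi> \<psi>
    by blast
  have out: "frame_decode ` printed M (outside_state M) (?\<Omega> e) ?in
      = {B \<in> frames 1. open_ball_of 1 B \<inter> (Rn 1 - ?X (of_rat e)) \<noteq> {}}" if "0 \<le> e" "e \<le> 1" for e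
  proof -
    have "outputs_open_set M 1 (?\<Omega> e) ?in (?X (of_rat e))"
      using that
      by (intro M real_analytic_map_cubic_map hyperbolic_sink_cubic_map map_oracle_cubic)
        (auto simp: point_oracle_def)
    then show ?thesis by (simp only: outputs_open_set_def)
  qed
  have "(\<lambda>i. if i = 0 then 1 else 0) \<in> open_ball_of 1 ?B \<inter> (Rn 1 - ?X (of_rat 0))"
    using not_in_basin_cubic_map
    by (auto simp: open_ball_of_def topspace_Euclidean_space of_rat_divide simp del: basin.simps)
  \<comment> \<open>For e = 0 the fixed point 1, the center of the ball, lies outside the basin, so
    the ball has to be printed at some time \<open>t\<close>.\<close>
  then have "?B \<in> frame_decode ` printed M (outside_state M) (?\<Omega> 0) ?in"
    by (subst out) (auto simp: frames_def)
  then obtain t Ts where t: "machine_run M (?\<Omega> 0) ?in t = (outside_state M, Ts)"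
      "?B = frame_decode (read_number (Ts ! 2))"
    by (auto simp: printed_def)
  obtain F where F: "finite F"
      "\<And>\<Omega>'. \<forall>q\<in>F. \<Omega>' q = ?\<Omega> 0 q \<Longrightarrow> machine_run M \<Omega>' ?in t = machine_run M (?\<Omega> 0) ?in t"
    using machine_run_finite_use by metis
  \<comment> \<open>Even queries concern the sink, whose oracle is the same for all
    \<open>e\<close>; for them the unspecified value of \<open>projr\<close> is harmless. Odd
    queries are settled by the decoded cube and precision.\<close>
  have "eventually (\<lambda>N. ?\<Omega> (?e N) q = ?\<Omega> 0 q) sequentially" for q
    using eventually_cubic_oracle[of "frame_decode (fst (prod_decode (projr (sum_decode q))))"
        "snd (prod_decode (projr (sum_decode q)))"]
    by eventually_elim (auto simp: joint_oracle_def split: sum.split prod.split)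
  then have "eventually (\<lambda>N. \<forall>q\<in>F. ?\<Omega> (?e N) q = ?\<Omega> 0 q) sequentially"
    using F(1) by (simp add: eventually_ball_finite)
  then obtain N where "\<forall>q\<in>F. ?\<Omega> (?e N) q = ?\<Omega> 0 q"
    by (auto simp: eventually_sequentially)
  \<comment> \<open>The perturbed run has the same configuration at time \<open>t\<close> and prints
    the same ball, although this ball now lies inside the basin.\<close>
  from F(2)[OF this] t have "?B \<in> frame_decode ` printed M (outside_state M) (?\<Omega> (?e N)) ?in"
    by (fastforce simp: printed_def)
  then have "open_ball_of 1 ?B \<inter> (Rn 1 - ?X (of_rat (?e N))) \<noteq> {}"
    by (subst (asm) out) (auto simp: divide_simps)
  moreover have "open_ball_of 1 ?B \<subseteq> ?X (of_rat (?e N))"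
    by (rule open_ball_subset_basin_cubic_map) (auto simp: divide_simps)
  ultimately show False by blast
qed

end
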